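(* Let $\Omega=[a,b]\times[c,d]$ and let $s_{kl}\in\mathcal{S}_{kl}^{\Delta\lambda,\Delta\mu}(\Omega)$, $s_{kl}(x,y)=\sum_{i=-k}^{g}\sum_{j=-l}^{h}b_{ij}B_i^{k+1}(x)B_j^{l+1}(y)$, be given such that $\iint_\Omega s_{kl}(x,y)\,dx\,dy=0$. Let $s_k\in\mathcal{S}_k^{\Delta\lambda}[a,b]$, $s_l\in\mathcal{S}_l^{\Delta\mu}[c,d]$ be defined as $$s_k(x):=\int_c^d s_{kl}(x,y)\,dy,\qquad s_l(y):=\int_a^b s_{kl}(x,y)\,dx,$$ with representations $$s_k(x)=\sum_{i=-k}^{g}v_iB_i^{k+1}(x),\qquad s_l(y)=\sum_{j=-l}^{h}u_jB_j^{l+1}(y).$$ Then the independent part of the bivariate density $s_{kl}(x,y)$ admits the spline representation $$s_{kl}^{ind}(x,y)=s_k(x)+s_l(y)=\sum_{i=-k}^{g}\sum_{j=-l}^{h}(v_{ij}+u_{ij})B_i^{k+1}(x)B_j^{l+1}(y),$$ and the interactive part is expressed as the spline $$s_{kl}^{int}(x,y)=s_{kl}(x,y)-s_{kl}^{ind}(x,y)=\sum_{i=-k}^{g}\sum_{j=-l}^{h}(b_{ij}-v_{ij}-u_{ij})B_i^{k+1}(x)B_j^{l+1}(y),$$ where $v_{ij}:=\frac{1}{d-c}v_i$ and $u_{ij}:=\frac{1}{b-a}u_j$ for all $i,j$.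
   Context: Degrees $k,l>0$. Knots: $\Delta\lambda$: $\lambda_0=a<\lambda_1<\dots<\lambda_g<b=\lambda_{g+1}$; $\Delta\mu$: $\mu_0=c<\mu_1<\dots<\mu_h<d=\mu_{h+1}$; extended by coincident additional knots $\lambda_{-k}=\dots=\lambda_{-1}=a$, $\lambda_{g+2}=\dots=\lambda_{g+k+1}=b$, $\mu_{-l}=\dots=\mu_{-1}=c$, $\mu_{h+2}=\dots=\mu_{h+l+1}=d$. $B_i^{k+1}(x)$ ($i=-k,\dots,g$) denotes the (partition-of-unity normalized) B-spline of degree $k$ on the knots $\lambda_i,\dots,\lambda_{i+k+1}$; similarly $B_j^{l+1}(y)$ ($j=-l,\dots,h$) of degree $l$ on $\mu_j,\dots,\mu_{j+l+1}$. $\mathcal{S}_k^{\Delta\lambda}[a,b]$ and $\mathcal{S}_l^{\Delta\mu}[c,d]$ are the spaces of polynomial splines spanned by the $B_i^{k+1}$ and by the $B_j^{l+1}$, respectively; $\mathcal{S}_{kl}^{\Delta\lambda,\Delta\mu}(\Omega)$ is the space of tensor product splines $\sum_{i=-k}^{g}\sum_{j=-l}^{h}b_{ij}B_i^{k+1}(x)B_j^{l+1}(y)$, $b_{ij}\in\mathbb{R}$. A zero-integral spline $s_{kl}$ on $\Omega$ represents the centred log-ratio (clr) transform of a bivariate density. For a product reference measure $\mathsf{P}=\mathsf{P}_X\times\mathsf{P}_Y$, the clr marginals of a clr-transformed density $s$ are $\int s(x,y)\,d\mathsf{P}_Y(y)$ and $\int s(x,y)\,d\mathsf{P}_X(x)$;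 the independent part (in clr form) is the sum of the two clr marginals, and the interactive part is the difference of $s$ and its independent part. The setting focuses on the Lebesgue measure as reference measure (or its normalized counterpart, the uniform measure).
   Formalization: The chain s_k+s_l = ΣΣ(v_ij+u_ij)B_iB_j fails unless the scaling matches; proved instead: with uniform measures the independent part is s_k/(d-c)+s_l/(b-a) with coefficients v_ij+u_ij; with Lebesgue measure it is s_k+s_l with coefficients v_i+u_j; interactive parts accordingly. *)

theory Defs
  imports "HOL-Analysis.Analysis"
begin

text \<open>The first conjunct includes the boundary knot \<open>t 0 = a\<close>, the last one \<open>t (g + 1) = b\<close>;
  the middle one yields \<open>a < t 1 < \<dots> < t g < b\<close>.\<close>

definition extended_knots :: "nat \<Rightarrow> nat \<Rightarrow> real \<Rightarrow> real \<Rightarrow> (int \<Rightarrow> real) \<Rightarrow> bool" where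
  "extended_knots k g a b t \<longleftrightarrow>
     (\<forall>i\<in>{- int k..0}. t i = a) \<and>
     (\<forall>i\<in>{0..int g}. t i < t (i + 1)) \<and>
     (\<forall>i\<in>{int g + 1..int g + int k + 1}. t i = b)"

text \<open>The Cox--de Boor recursion; \<open>bspline b t k i\<close> is the normalized B-spline of degree \<open>k\<close>
  (order \<open>k + 1\<close>) on the knots \<open>t i, \<dots>, t (i + k + 1)\<close>. Terms with coincident knots in the
  denominator vanish because \<open>x / 0 = 0\<close>. The last nonempty knot interval is closed at the right
  end point \<open>b\<close>, so that the B-splines form a partition of unity on all of \<open>[a, b]\<close>.\<close>

primrec bspline :: "real \<Rightarrow> (int \<Rightarrow> real) \<Rightarrow> nat \<Rightarrow> int \<Rightarrow> real \<Rightarrow> real" where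
  "bspline b t 0 i x =
     (if t i \<le> x \<and> x < t (i + 1) \<or> x = b \<and> t i < b \<and> t (i + 1) = b then 1 else 0)"
| "bspline b t (Suc k) i x =
     (x - t i) / (t (i + int k + 1) - t i) * bspline b t k i x +
     (t (i + int k + 2) - x) / (t (i + int k + 2) - t (i + 1)) * bspline b t k (i + 1) x"

definition spline :: "nat \<Rightarrow> nat \<Rightarrow> real \<Rightarrow> (int \<Rightarrow> real) \<Rightarrow> (int \<Rightarrow> real) \<Rightarrow> real \<Rightarrow> real" where
  "spline k g b t v x = (\<Sum>i = - int k..int g. v i * bspline b t k i x)"

definition tensor_spline ::
  "nat \<Rightarrow> nat \<Rightarrow> real \<Rightarrow> (int \<Rightarrow> real) \<Rightarrow> nat \<Rightarrow> nat \<Rightarrow> real \<Rightarrow> (int \<Rightarrow> real) \<Rightarrow>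
    (int \<Rightarrow> int \<Rightarrow> real) \<Rightarrow> real \<Rightarrow> real \<Rightarrow> real" where
  "tensor_spline k g b t l h d r \<beta> x y =
     (\<Sum>i = - int k..int g. \<Sum>j = - int l..int h.
        \<beta> i j * bspline b t k i x * bspline d r l j y)"

text \<open>Splines are functions on \<open>[a, b]\<close> and on \<open>[a, b] \<times> [c, d]\<close>; values outside are irrelevant.\<close>

definition spline_space :: "nat \<Rightarrow> nat \<Rightarrow> real \<Rightarrow> real \<Rightarrow> (int \<Rightarrow> real) \<Rightarrow> (real \<Rightarrow> real) set" where
  "spline_space k g a b t = {s. \<exists>v. \<forall>x\<in>{a..b}. s x = spline k g b t v x}"

definition tensor_spline_space ::
  "nat \<Rightarrow> nat \<Rightarrow> real \<Rightarrow> real \<Rightarrow> (int \<Rightarrow> real) \<Rightarrow> nat \<Rightarrow> nat \<Rightarrow> real \<Rightarrow> real \<Rightarrow> (int \<Rightarrow> real) \<Rightarrow>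
    (real \<Rightarrow> real \<Rightarrow> real) set" where
  "tensor_spline_space k g a b t l h c d r =
     {s. \<exists>\<beta>. \<forall>x\<in>{a..b}. \<forall>y\<in>{c..d}. s x y = tensor_spline k g b t l h d r \<beta> x y}"

text \<open>Clr marginals, independent and interactive part of a clr-transformed bivariate density
  \<open>s\<close> with respect to the product reference measure \<open>P \<times> Q\<close>.\<close>

definition clr_marginal_X :: "real measure \<Rightarrow> (real \<Rightarrow> real \<Rightarrow> real) \<Rightarrow> real \<Rightarrow> real" where
  "clr_marginal_X Q s x = (\<integral>y. s x y \<partial>Q)"

definition clr_marginal_Y :: "real measure \<Rightarrow> (real \<Rightarrow> real \<Rightarrow> real) \<Rightarrow> real \<Rightarrow> real" where
  "clr_marginal_Y P s y = (\<integral>x. s x y \<partial>P)"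

definition independent_part ::
  "real measure \<Rightarrow> real measure \<Rightarrow> (real \<Rightarrow> real \<Rightarrow> real) \<Rightarrow> real \<Rightarrow> real \<Rightarrow> real" where
  "independent_part P Q s x y = clr_marginal_X Q s x + clr_marginal_Y P s y"

definition interactive_part ::
  "real measure \<Rightarrow> real measure \<Rightarrow> (real \<Rightarrow> real \<Rightarrow> real) \<Rightarrow> real \<Rightarrow> real \<Rightarrow> real" where
  "interactive_part P Q s x y = s x y - independent_part P Q s x y"

text \<open>With Lebesgue measure as reference the independent part is \<open>s\<^sub>k x + s\<^sub>l y\<close> for the plain
  integrals \<open>s\<^sub>k\<close>, \<open>s\<^sub>l\<close> of \<open>s\<close>. The factors \<open>1 / (d - c)\<close> and \<open>1 / (b - a)\<close> come in with the
  normalized (uniform) reference measures, whose clr marginals are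
  \<open>s\<^sub>k x / (d - c)\<close> and \<open>s\<^sub>l y / (b - a)\<close>.\<close>

abbreviation lebesgue_ref :: "real \<Rightarrow> real \<Rightarrow> real measure" where
  "lebesgue_ref a b \<equiv> restrict_space lborel {a..b}"

abbreviation uniform_ref :: "real \<Rightarrow> real \<Rightarrow> real measure" where
  "uniform_ref a b \<equiv> uniform_measure (lebesgue_ref a b) {a..b}"

end

theory Submission
  imports Defs
begin

text \<open>Integrating a tensor product spline in one variable replaces the B-splines in that variable
  by their integrals and leaves a univariate spline in the other variable. Since the B-splines in
  each variable sum to 1, a univariate spline is a tensor product spline whose coefficients are
  constant in the other index; hence \<open>s\<^sub>k x + s\<^sub>l y\<close> has the coefficients \<open>v i + u j\<close>. Normalizing
  the reference measures divides the two marginals by \<open>d - c\<close> and \<open>b - a\<close>.\<close>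

section \<open>Sums over integer intervals\<close>

lemma sum_atLeastAtMost_int_telescope:
  fixes f :: "int \<Rightarrow> 'a::ab_group_add"
  shows "(\<Sum>i = 0..int n. f i - f (i + 1)) = f 0 - f (int n + 1)"
proof (induction n)
  case 0
  then show ?case by simp
next
  case (Suc n)
  have "{0..int (Suc n)} = insert (int (Suc n)) {0..int n}"
    by auto
  with Suc show ?case
    by (simp add: add.commute)
qed

lemma sum_atLeastAtMost_int_shift:
  fixes f :: "int \<Rightarrow> 'a::comm_monoid_add"
  shows "(\<Sum>i = m..n. f (i + 1)) = (\<Sum>i = m + 1..n + 1. f i)"
  by (rule sum.reindex_bij_witness[of _ "\<lambda>i. i - 1" "\<lambda>i. i + 1"]) auto

section \<open>Extended knots and the partition of unity\<close>

context
  fixes k g :: nat and a b :: real and t :: "int \<Rightarrow> real"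
  assumes knots: "extended_knots k g a b t"
begin

lemma knots_left: "- int k \<le> i \<Longrightarrow> i \<le> 0 \<Longrightarrow> t i = a"
  and knots_right: "int g + 1 \<le> i \<Longrightarrow> i \<le> int g + int k + 1 \<Longrightarrow> t i = b"
  and knots_step: "0 \<le> i \<Longrightarrow> i \<le> int g \<Longrightarrow> t i < t (i + 1)"
  using knots by (auto simp: extended_knots_def)

lemma knots_strict_mono:
  assumes "0 \<le> i" "i < j" "j \<le> int g + 1"
  shows "t i < t j"
proof -
  have "j \<le> int g + 1 \<longrightarrow> t i < t j"
    using assms(2)
  proof (induction rule: int_gr_induct)
    case base
    then show ?case using knots_step[of i] assms(1) by auto
  next
    case (step j)
    then show ?case using knots_step[of j] assms(1) by auto
  qed
  with assms(3) show ?thesis by simp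
qed

lemma knots_endpoints_less: "a < b"
  using knots_strict_mono[of 0 "int g + 1"] knots_left[of 0] knots_right[of "int g + 1"] by simp

lemma knots_less_right:
  assumes "- int k \<le> i" "i \<le> int g"
  shows "t i < b"
proof (cases "i \<le> 0")
  case True
  then show ?thesis using knots_left[of i] assms knots_endpoints_less by simp
next
  case False
  then show ?thesis
    using knots_strict_mono[of i "int g + 1"] knots_right[of "int g + 1"] assms by simp
qed

text \<open>Keeps the Cox-de Boor denominators nonzero. As \<open>- int p \<le> i\<close>, the right
  index is at least 1, past the block of knots equal to \<open>a\<close>; as
  \<open>i \<le> int g\<close>, the left knot lies before the block equal to
  \<open>b\<close>.\<close>

lemma knots_support_nonempty:
  assumes "p \<le> k" "- int p \<le> i" "i \<le> int g"
  shows "t i < t (i + int p + 1)"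
proof (cases "i + int p + 1 \<le> int g")
  case True
  show ?thesis
  proof (cases "i \<le> 0")
    case True
    then show ?thesis
      using knots_left[of i] knots_left[of 0] knots_strict_mono[of 0 "i + int p + 1"] assms
        \<open>i + int p + 1 \<le> int g\<close> by simp
  next
    case False
    then show ?thesis
      using knots_strict_mono[of i "i + int p + 1"] True by simp
  qed
next
  case False
  then show ?thesis
    using knots_right[of "i + int p + 1"] knots_less_right[of i] assms by simp
qed

text \<open>Each summand is a difference of consecutive step functions, so the sum telescopes to the
  steps at \<open>a\<close> and \<open>b\<close>.\<close>

lemma bspline_degree_0_partition:
  assumes "x \<in> {a..b}"
  shows "(\<Sum>i = 0..int g. bspline b t 0 i x) = 1"
proof -
  \<comment> \<open>The constraint \<open>t i < b\<close> only matters at \<open>x = b\<close>, where the last knot interval is closed.\<close>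
  define e :: "int \<Rightarrow> real" where "e i = (if t i \<le> x \<and> t i < b then 1 else 0)" for i
  have "bspline b t 0 i x = e i - e (i + 1)" if "i \<in> {0..int g}" for i
  proof -
    have "t i < b" "t i < t (i + 1)" "t (i + 1) \<le> b"
      using that knots_less_right[of i] knots_step[of i] knots_less_right[of "i + 1"]
        knots_right[of "i + 1"] by (cases "i = int g"; simp; fail)+
    then show ?thesis
      using assms by (auto simp: e_def)
  qed
  then have "(\<Sum>i = 0..int g. bspline b t 0 i x) = (\<Sum>i = 0..int g. e i - e (i + 1))"
    by (intro sum.cong) auto
  also have "\<dots> = e 0 - e (int g + 1)"
    by (rule sum_atLeastAtMost_int_telescope)
  also have "\<dots> = 1"
    using assms knots_left[of 0] knots_right[of "int g + 1"] knots_endpoints_less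
    by (simp add: e_def)
  finally show ?thesis .
qed

text \<open>Induction on the degree over the fixed knots for degree \<open>k\<close>. The range
  starts at \<open>- int p\<close> because for smaller indices in the knot range all knots of the
  B-spline equal \<open>a\<close>.\<close>

lemma bspline_partition_of_unity_lower_degree:
  assumes x: "x \<in> {a..b}" and "p \<le> k"
  shows "(\<Sum>i = - int p..int g. bspline b t p i x) = 1"
  using \<open>p \<le> k\<close>
proof (induction p)
  case 0
  then show ?case using bspline_degree_0_partition[OF x] by (simp del: bspline.simps)
next
  case (Suc p)
  \<comment> \<open>\<open>L i + R i\<close> is the B-spline of degree \<open>p\<close>, as the two weights on the same knots add up to 1;
    the unpaired terms at either end vanish because their denominators are 0.\<close>
  define L where "L i = (x - t i) / (t (i + int p + 1) - t i) * bspline b t p i x" for i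
  define R where
    "R i = (t (i + int p + 1) - x) / (t (i + int p + 1) - t i) * bspline b t p i x" for i
  have "bspline b t (Suc p) i x = L i + R (i + 1)" for i
    by (simp add: L_def R_def add_ac)
  then have "(\<Sum>i = - int (Suc p)..int g. bspline b t (Suc p) i x)
      = (\<Sum>i = - int (Suc p)..int g. L i) + (\<Sum>i = - int (Suc p)..int g. R (i + 1))"
    by (simp only: sum.distrib)
  also have "(\<Sum>i = - int (Suc p)..int g. R (i + 1)) = (\<Sum>i = - int p..int g + 1. R i)"
    by (subst sum_atLeastAtMost_int_shift) simp
  also have "(\<Sum>i = - int (Suc p)..int g. L i) = (\<Sum>i = - int p..int g. L i)"
  proof (rule sum.mono_neutral_right)
    show "\<forall>i\<in>{- int (Suc p)..int g} - {- int p..int g}. L i = 0"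
    proof
      fix i assume "i \<in> {- int (Suc p)..int g} - {- int p..int g}"
      \<comment> \<open>Now \<open>i + int p + 1\<close> is 0, the last index with knot
        \<open>a\<close>.\<close>
      then have "i = - int (Suc p)" by auto
      then show "L i = 0"
        using knots_left[of i] knots_left[of 0] Suc.prems by (simp add: L_def)
    qed
  qed auto
  also have "(\<Sum>i = - int p..int g + 1. R i) = (\<Sum>i = - int p..int g. R i)"
  proof (rule sum.mono_neutral_right)
    show "\<forall>i\<in>{- int p..int g + 1} - {- int p..int g}. R i = 0"
    proof
      fix i assume "i \<in> {- int p..int g + 1} - {- int p..int g}"
      \<comment> \<open>The right index is now \<open>int g + int p + 2\<close>, still a knot equal
        to \<open>b\<close> since \<open>Suc p \<le> k\<close>.\<close>
      then have "i = int g + 1" by auto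
      then show "R i = 0"
        using knots_right[of i] knots_right[of "i + int p + 1"] Suc.prems by (simp add: R_def)
    qed
  qed auto
  also have "(\<Sum>i = - int p..int g. L i) + (\<Sum>i = - int p..int g. R i)
      = (\<Sum>i = - int p..int g. bspline b t p i x)"
    unfolding sum.distrib[symmetric]
  proof (rule sum.cong)
    fix i assume "i \<in> {- int p..int g}"
    then have "t i < t (i + int p + 1)"
      using knots_support_nonempty[of p i] Suc.prems by simp
    then have "(x - t i) / (t (i + int p + 1) - t i)
        + (t (i + int p + 1) - x) / (t (i + int p + 1) - t i) = 1"
      by (simp flip: add_divide_distrib)
    then show "L i + R i = bspline b t p i x"
      unfolding L_def R_def by (metis distrib_right mult_1)
  qed simp
  finally show ?case
    using Suc by (simp only: Suc_leD)
qed

lemma bspline_partition_of_unity: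
  "x \<in> {a..b} \<Longrightarrow> (\<Sum>i = - int k..int g. bspline b t k i x) = 1"
  using bspline_partition_of_unity_lower_degree by blast

end

section \<open>Integrability of B-splines\<close>

lemma borel_measurable_bspline [measurable]: "bspline b t k i \<in> borel_measurable borel"
proof (induction k arbitrary: i)
  case 0
  then show ?case unfolding bspline.simps by measurable
next
  case (Suc k)
  note [measurable] = Suc.IH
  show ?case unfolding bspline.simps by measurable
qed

text \<open>Together with measurability this gives integrability without any appeal to continuity,
  which fails in degree 0. The recursion multiplies by affine weights, bounded on a compact
  interval.\<close>

lemma bspline_bounded_on_Icc: "\<exists>M. \<forall>x\<in>{c..d}. \<bar>bspline b t k i x\<bar> \<le> M"
proof (induction k arbitrary: i)
  case 0
  show ?case by (intro exI[of _ 1]) simp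
next
  case (Suc k)
  have affine_mult: "\<exists>M. \<forall>x\<in>{c..d}. \<bar>(p * x + q) / r * f x\<bar> \<le> M"
    if f: "\<exists>M. \<forall>x\<in>{c..d}. \<bar>f x\<bar> \<le> M" for p q r :: real and f :: "real \<Rightarrow> real"
  proof -
    obtain M where M: "\<bar>f x\<bar> \<le> M" if "x \<in> {c..d}" for x
      using f by blast
    \<comment> \<open>As a product with \<open>inverse r\<close> the weight is continuous even for
      \<open>r = 0\<close>, the case of coincident knots.\<close>
    have "bounded ((\<lambda>x. (p * x + q) / r) ` {c..d})"
      by (intro compact_imp_bounded compact_continuous_image)
        (auto intro!: continuous_intros simp: divide_inverse)
    then obtain K where K: "\<bar>(p * x + q) / r\<bar> \<le> K" if "x \<in> {c..d}" for x
      unfolding bounded_iff real_norm_def by blast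
    have "\<bar>(p * x + q) / r * f x\<bar> \<le> K * M" if "x \<in> {c..d}" for x
      unfolding abs_mult using K[OF that] M[OF that] abs_ge_zero by (meson mult_mono order.trans)
    then show ?thesis by blast
  qed
  obtain M where M: "\<forall>x\<in>{c..d}. \<bar>(x - t i) / (t (i + int k + 1) - t i) * bspline b t k i x\<bar> \<le> M"
    using affine_mult[OF Suc.IH[of i], of 1 "- t i"] by auto
  obtain N where N: "\<forall>x\<in>{c..d}. \<bar>(t (i + int k + 2) - x) / (t (i + int k + 2) - t (i + 1))
      * bspline b t k (i + 1) x\<bar> \<le> N"
    using affine_mult[OF Suc.IH[of "i + 1"], of "- 1" "t (i + int k + 2)"] by auto
  have "\<bar>bspline b t (Suc k) i x\<bar> \<le> M + N" if "x \<in> {c..d}" for x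
    unfolding bspline.simps using M N that by (intro order.trans[OF abs_triangle_ineq] add_mono) auto
  then show ?case by blast
qed

lemma set_integrable_bspline: "set_integrable lborel {c..d} (bspline b t k i)"
proof -
  obtain M where "\<forall>x\<in>{c..d}. \<bar>bspline b t k i x\<bar> \<le> M"
    using bspline_bounded_on_Icc by blast
  then show ?thesis
    unfolding set_integrable_def
    by (intro integrableI_bounded_set_indicator[where B = M]) (auto simp: emeasure_lborel_Icc_eq)
qed

section \<open>Algebra and integration of tensor product splines\<close>

lemma tensor_spline_altdef:
  "tensor_spline k g b t l h d r \<beta> x y
    = spline l h d r (\<lambda>j. \<Sum>i = - int k..int g. \<beta> i j * bspline b t k i x) y"
  unfolding tensor_spline_def spline_def sum_distrib_right by (rule sum.swap)

text \<open>Carries the results on integration in \<open>y\<close> over to integration in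
  \<open>x\<close>.\<close>

lemma tensor_spline_swap:
  "tensor_spline k g b t l h d r \<beta> x y = tensor_spline l h d r k g b t (\<lambda>j i. \<beta> i j) y x"
  unfolding tensor_spline_def by (subst sum.swap) (simp add: mult_ac)

lemma tensor_spline_diff:
  "tensor_spline k g b t l h d r (\<lambda>i j. \<beta> i j - \<gamma> i j) x y
    = tensor_spline k g b t l h d r \<beta> x y - tensor_spline k g b t l h d r \<gamma> x y"
  by (simp add: tensor_spline_def left_diff_distrib sum_subtractf)

lemma set_integrable_spline: "set_integrable lborel {c..d} (spline l h b t v)"
  using set_integrable_bspline[of c d b t l]
  by (simp add: spline_def[abs_def] set_integrable_def sum_distrib_left mult.left_commute)

lemma set_lebesgue_integral_spline:
  "(LINT y:{c..d}|lborel. spline l h b t v y)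
    = (\<Sum>j = - int l..int h. v j * (LINT y:{c..d}|lborel. bspline b t l j y))"
  using set_integrable_bspline[of c d b t l]
  by (simp add: spline_def set_integrable_def set_lebesgue_integral_def sum_distrib_left
      mult.left_commute)

lemma set_integrable_tensor_spline:
  "set_integrable lborel {c..e} (tensor_spline k g b t l h d r \<beta> x)"
  unfolding tensor_spline_altdef[abs_def] by (rule set_integrable_spline)

text \<open>For fixed \<open>x\<close> the integrand is a univariate spline in \<open>y\<close> with
  coefficients depending on \<open>x\<close>; exchanging the two sums exhibits the coefficients of
  the marginal.\<close>

lemma set_lebesgue_integral_tensor_spline:
  "(LINT y:{c..e}|lborel. tensor_spline k g b t l h d r \<beta> x y)
    = spline k g b t (\<lambda>i. \<Sum>j = - int l..int h. \<beta> i j * (LINT y:{c..e}|lborel. bspline d r l j y)) x"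
  unfolding tensor_spline_altdef set_lebesgue_integral_spline
  unfolding spline_def sum_distrib_right by (subst sum.swap) (simp add: mult_ac)

text \<open>The weights \<open>p\<close> and \<open>q\<close> serve both normalizations: 1 and 1 for
  Lebesgue measure, \<open>1 / (d - c)\<close> and \<open>1 / (b - a)\<close> for the uniform
  measures.\<close>

lemma tensor_spline_add_marginals:
  assumes "extended_knots k g a b t" "extended_knots l h c d r" "x \<in> {a..b}" "y \<in> {c..d}"
  shows "tensor_spline k g b t l h d r (\<lambda>i j. p * v i + q * u j) x y
    = p * spline k g b t v x + q * spline l h d r u y"
proof -
  have scaled: "z * spline n m e w f \<xi> = (\<Sum>i = - int n..int m. z * f i * bspline e w n i \<xi>)"
    for z n m e w f \<xi>
    by (simp add: spline_def sum_distrib_left mult.assoc)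
  \<comment> \<open>Each marginal is multiplied by the B-spline sum in the other variable, which
    equals 1; then both sides are double sums and agree termwise.\<close>
  have "tensor_spline k g b t l h d r (\<lambda>i j. p * v i + q * u j) x y
    = p * spline k g b t v x * (\<Sum>j = - int l..int h. bspline d r l j y)
      + (\<Sum>i = - int k..int g. bspline b t k i x) * (q * spline l h d r u y)"
    unfolding scaled sum_product tensor_spline_def sum.distrib[symmetric]
    by (simp add: algebra_simps)
  then show ?thesis
    using bspline_partition_of_unity[OF assms(1,3)] bspline_partition_of_unity[OF assms(2,4)]
    by simp
qed

section \<open>Integrals against the reference measures\<close>

lemma integral_lebesgue_ref: "(\<integral>x. f x \<partial>lebesgue_ref a b) = (LINT x:{a..b}|lborel. f x)"
  for f :: "real \<Rightarrow> real"
  by (simp add: integral_restrict_space set_lebesgue_integral_def)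

lemma integral_uniform_ref:
  fixes f :: "real \<Rightarrow> real"
  assumes "a < b" and "set_integrable lborel {a..b} f"
  shows "(\<integral>x. f x \<partial>uniform_ref a b) = 1 / (b - a) * (LINT x:{a..b}|lborel. f x)"
proof -
  \<comment> \<open>\<open>integral_density\<close> asks for measurability, which integrability
    supplies.\<close>
  have [measurable]: "f \<in> borel_measurable (lebesgue_ref a b)"
    using assms(2)
    by (intro borel_measurable_integrable) (simp add: set_integrable_def integrable_restrict_space)
  have [measurable]: "{a..b} \<in> sets (lebesgue_ref a b)"
    by (simp add: sets_restrict_space_iff)
  \<comment> \<open>On \<open>{a..b}\<close> the indicator is 1 and the total mass is
    \<open>b - a\<close>, so the density is constant.\<close>
  have "uniform_ref a b = density (lebesgue_ref a b) (\<lambda>x. ennreal (1 / (b - a)))"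
    unfolding uniform_measure_def using assms(1)
    by (intro density_cong; (measurable; fail)?)
      (auto simp: emeasure_restrict_space space_restrict_space divide_ennreal simp flip: ennreal_1)
  then show ?thesis
    using assms(1) by (simp add: integral_density integral_lebesgue_ref)
qed

section \<open>Independent and interactive parts under both reference measures\<close>

theorem theorem5p4:
  fixes a b c d :: real and k l g h :: nat
    and \<kappa> \<mu> :: "int \<Rightarrow> real"
    and s :: "real \<Rightarrow> real \<Rightarrow> real" and \<beta> :: "int \<Rightarrow> int \<Rightarrow> real"
    and sk sl :: "real \<Rightarrow> real"
  assumes "k > 0" and "l > 0"
    and "extended_knots k g a b \<kappa>" and "extended_knots l h c d \<mu>"
    and "s \<in> tensor_spline_space k g a b \<kappa> l h c d \<mu>"
    and "\<forall>x\<in>{a..b}. \<forall>y\<in>{c..d}. s x y = tensor_spline k g b \<kappa> l h d \<mu> \<beta> x y"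
    and "(LINT p:{a..b} \<times> {c..d}|lborel. s (fst p) (snd p)) = 0"
    and "\<forall>x\<in>{a..b}. sk x = (LINT y:{c..d}|lborel. s x y)"
    and "\<forall>y\<in>{c..d}. sl y = (LINT x:{a..b}|lborel. s x y)"
  shows "sk \<in> spline_space k g a b \<kappa> \<and> sl \<in> spline_space l h c d \<mu> \<and>
    (\<forall>v u.
      (\<forall>x\<in>{a..b}. sk x = spline k g b \<kappa> v x) \<and> (\<forall>y\<in>{c..d}. sl y = spline l h d \<mu> u y) \<longrightarrow>
      (\<forall>x\<in>{a..b}. \<forall>y\<in>{c..d}.
        independent_part (uniform_ref a b) (uniform_ref c d) s x y
          = 1 / (d - c) * sk x + 1 / (b - a) * sl y \<and>
        independent_part (uniform_ref a b) (uniform_ref c d) s x y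
          = tensor_spline k g b \<kappa> l h d \<mu>
              (\<lambda>i j. 1 / (d - c) * v i + 1 / (b - a) * u j) x y \<and>
        interactive_part (uniform_ref a b) (uniform_ref c d) s x y
          = tensor_spline k g b \<kappa> l h d \<mu>
              (\<lambda>i j. \<beta> i j - 1 / (d - c) * v i - 1 / (b - a) * u j) x y \<and>
        independent_part (lebesgue_ref a b) (lebesgue_ref c d) s x y = sk x + sl y \<and>
        independent_part (lebesgue_ref a b) (lebesgue_ref c d) s x y
          = tensor_spline k g b \<kappa> l h d \<mu> (\<lambda>i j. v i + u j) x y \<and>
        interactive_part (lebesgue_ref a b) (lebesgue_ref c d) s x y
          = tensor_spline k g b \<kappa> l h d \<mu> (\<lambda>i j. \<beta> i j - v i - u j) x y))"
proof -
  note \<kappa> = assms(3) and \<mu> = assms(4) and s_eq = assms(6) and sk = assms(8) and sl = assms(9)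
  have "a < b" "c < d"
    using knots_endpoints_less[OF \<kappa>] knots_endpoints_less[OF \<mu>] by auto
  let ?T = "tensor_spline k g b \<kappa> l h d \<mu>"
  have cong_y: "(LINT y:{c..d}|lborel. s x y) = (LINT y:{c..d}|lborel. ?T \<beta> x y)"
    if "x \<in> {a..b}" for x
    using s_eq that by (intro set_lebesgue_integral_cong) auto
  have cong_x: "(LINT x:{a..b}|lborel. s x y)
      = (LINT x:{a..b}|lborel. tensor_spline l h d \<mu> k g b \<kappa> (\<lambda>j i. \<beta> i j) y x)"
    if "y \<in> {c..d}" for y
    using s_eq that tensor_spline_swap[of k g b \<kappa> l h d \<mu> \<beta>]
    by (intro set_lebesgue_integral_cong) auto
  have "sk \<in> spline_space k g a b \<kappa>"
    using sk cong_y unfolding spline_space_def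
    by (auto simp: set_lebesgue_integral_tensor_spline)
  moreover have "sl \<in> spline_space l h c d \<mu>"
    using sl cong_x unfolding spline_space_def
    by (auto simp: set_lebesgue_integral_tensor_spline)
  \<comment> \<open>The uniform marginals need integrable sections; on the rectangle
    \<open>s\<close> agrees with the tensor spline, whose sections are integrable.\<close>
  moreover have "set_integrable lborel {c..d} (s x)" if "x \<in> {a..b}" for x
    using set_integrable_tensor_spline[of c d k g b \<kappa> l h d \<mu> \<beta> x] s_eq that
    by (subst set_integrable_cong[OF refl refl, where f' = "?T \<beta> x"]) auto
  then have X: "clr_marginal_X (lebesgue_ref c d) s x = sk x"
      "clr_marginal_X (uniform_ref c d) s x = 1 / (d - c) * sk x" if "x \<in> {a..b}" for x
    using that sk \<open>c < d\<close>
    by (simp_all add: clr_marginal_X_def integral_lebesgue_ref integral_uniform_ref)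
  have "set_integrable lborel {a..b} (\<lambda>x. s x y)" if "y \<in> {c..d}" for y
    using set_integrable_tensor_spline[of a b l h d \<mu> k g b \<kappa> "\<lambda>j i. \<beta> i j" y] s_eq that
      tensor_spline_swap[of k g b \<kappa> l h d \<mu> \<beta>]
    by (subst set_integrable_cong[OF refl refl,
          where f' = "tensor_spline l h d \<mu> k g b \<kappa> (\<lambda>j i. \<beta> i j) y"]) auto
  then have Y: "clr_marginal_Y (lebesgue_ref a b) s y = sl y"
      "clr_marginal_Y (uniform_ref a b) s y = 1 / (b - a) * sl y" if "y \<in> {c..d}" for y
    using that sl \<open>a < b\<close>
    by (simp_all add: clr_marginal_Y_def integral_lebesgue_ref integral_uniform_ref)
  note marginals = tensor_spline_add_marginals[OF \<kappa> \<mu>]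
  ultimately show ?thesis
    \<comment> \<open>The two instances of \<open>marginals\<close> give the uniform and the
      Lebesgue case. For the interactive part, \<open>diff_diff_eq\<close> groups the subtracted
      coefficients so that \<open>tensor_spline_diff\<close> splits off the independent
      part.\<close>
    using s_eq X Y marginals[of _ _ "1 / (d - c)" _ "1 / (b - a)"]
      marginals[where p = 1 and q = 1]
    by (simp add: interactive_part_def independent_part_def tensor_spline_diff diff_diff_eq)
qed

end
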